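(* Let $(U_i)_{i\ge0}$ be defined by $U_0=1$, $U_1=13$, $U_2=163$ and $U_{i+3}=12U_{i+2}+6U_{i+1}+12U_i$ for all $i\ge0$. There exists a unique $2$-adic integer $\zeta$ with the property that if $(i_n)_{n\ge0}$ is a sequence of non-negative integers such that $\nu_2(U_{i_n})-\frac{i_n}{2}\to\infty$, then $i_n\to\zeta$ in $\mathbb{Z}_2$.
   Context: $\nu_2$ denotes the $2$-adic valuation and $\mathbb{Z}_2$ the ring of $2$-adic integers with its $2$-adic topology. *)

theory Defs
  imports Complex_Main "HOL-Computational_Algebra.Computational_Algebra"
begin

text \<open>
  The ring of 2-adic integers as the inverse limit of the rings of integers modulo \<open>2 ^ n\<close>.
  The condition below also forces \<open>0 \<le> x n < 2 ^ n\<close>, so that every residue class is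
  represented by its least non-negative element.
\<close>

typedef padic2 = "{x :: nat \<Rightarrow> int. \<forall>n. x (Suc n) mod 2 ^ n = x n}"
  morphisms residue Abs_padic2
  by (rule exI[of _ "\<lambda>_. 0"]) simp

setup_lifting type_definition_padic2

lemma residue_Suc_mod: "residue x (Suc n) mod 2 ^ n = residue x n"
  using residue[of x] by simp

lemma residue_mod_self [simp]: "residue x n mod 2 ^ n = residue x n"
  by (metis residue_Suc_mod mod_mod_trivial)

lemma residue_0_right [simp]: "residue x 0 = 0"
  using residue_mod_self[of x 0] by simp

lemma residue_mod: "m \<le> n \<Longrightarrow> residue x n mod 2 ^ m = residue x m"
proof (induction n rule: dec_induct)
  case (step n)
  have "residue x (Suc n) mod 2 ^ m = residue x (Suc n) mod 2 ^ n mod 2 ^ m"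
    using step.hyps by (simp add: mod_mod_cancel le_imp_power_dvd)
  then show ?case by (simp add: residue_Suc_mod step.IH)
qed simp

lemma padic2_eqI: "(\<And>n. residue x n = residue y n) \<Longrightarrow> x = y"
  by (simp add: residue_inject[symmetric] fun_eq_iff)

lemma mod_pow2_Suc_mod: "(a :: int) mod 2 ^ Suc n mod 2 ^ n = a mod 2 ^ n"
  by (rule mod_mod_cancel) simp

instantiation padic2 :: comm_ring_1
begin

lift_definition zero_padic2 :: padic2 is "\<lambda>n. 0" by simp

lift_definition one_padic2 :: padic2 is "\<lambda>n. 1 mod 2 ^ n"
  using mod_pow2_Suc_mod by blast

lift_definition plus_padic2 :: "padic2 \<Rightarrow> padic2 \<Rightarrow> padic2"
  is "\<lambda>x y n. (x n + y n) mod 2 ^ n"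
  by (metis mod_pow2_Suc_mod mod_add_eq)

lift_definition uminus_padic2 :: "padic2 \<Rightarrow> padic2" is "\<lambda>x n. (- x n) mod 2 ^ n"
  by (metis mod_pow2_Suc_mod mod_minus_eq)

lift_definition minus_padic2 :: "padic2 \<Rightarrow> padic2 \<Rightarrow> padic2"
  is "\<lambda>x y n. (x n - y n) mod 2 ^ n"
  by (metis mod_pow2_Suc_mod mod_diff_eq)

lift_definition times_padic2 :: "padic2 \<Rightarrow> padic2 \<Rightarrow> padic2"
  is "\<lambda>x y n. (x n * y n) mod 2 ^ n"
  by (metis mod_pow2_Suc_mod mod_mult_eq)

instance
proof
  fix a b c :: padic2
  note rep = zero_padic2.rep_eq one_padic2.rep_eq plus_padic2.rep_eq uminus_padic2.rep_eq
    minus_padic2.rep_eq times_padic2.rep_eq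
  show "a * b * c = a * (b * c)"
    by (rule padic2_eqI) (simp add: rep mod_simps mult.assoc)
  show "a * b = b * a"
    by (rule padic2_eqI) (simp add: rep mult.commute)
  show "1 * a = a"
    by (rule padic2_eqI) (simp add: rep mod_simps)
  show "a + b + c = a + (b + c)"
    by (rule padic2_eqI) (simp add: rep mod_simps add.assoc)
  show "a + b = b + a"
    by (rule padic2_eqI) (simp add: rep add.commute)
  show "0 + a = a"
    by (rule padic2_eqI) (simp add: rep)
  show "- a + a = 0"
    by (rule padic2_eqI) (simp add: rep mod_simps)
  show "a - b = a + - b"
    by (rule padic2_eqI) (simp add: rep mod_simps)
  show "(a + b) * c = a * c + b * c"
    by (rule padic2_eqI) (simp add: rep mod_simps distrib_right)
  have "residue (0 :: padic2) 1 \<noteq> residue 1 1"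
    by (simp add: rep)
  then show "(0 :: padic2) \<noteq> 1" by metis
qed

end

lemma residue_zero [simp]: "residue 0 n = 0"
  by (simp add: zero_padic2.rep_eq)

lemma residue_one: "residue 1 n = 1 mod 2 ^ n"
  by (simp add: one_padic2.rep_eq)

lemma residue_add: "residue (x + y) n = (residue x n + residue y n) mod 2 ^ n"
  by (simp add: plus_padic2.rep_eq)

lemma residue_diff: "residue (x - y) n = (residue x n - residue y n) mod 2 ^ n"
  by (simp add: minus_padic2.rep_eq)

lemma residue_mult: "residue (x * y) n = (residue x n * residue y n) mod 2 ^ n"
  by (simp add: times_padic2.rep_eq)

lemma residue_of_nat: "residue (of_nat k) n = int k mod 2 ^ n"
  by (induction k) (simp_all add: residue_add residue_one mod_simps)

lemma residue_two_power: "residue (2 ^ k) n = 2 ^ k mod 2 ^ n"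
  using residue_of_nat[of "2 ^ k" n] by simp

lemma residue_diff_eq_0_iff: "residue (x - y) n = 0 \<longleftrightarrow> residue x n = residue y n"
  by (metis residue_diff residue_mod_self mod_eq_dvd_iff dvd_eq_mod_eq_0)

lemma two_power_dvd_iff: "2 ^ k dvd x \<longleftrightarrow> residue x k = 0"
proof
  assume "2 ^ k dvd x"
  then show "residue x k = 0"
    by (auto simp: residue_mult residue_two_power elim!: dvdE)
next
  assume x0: "residue x k = 0"
  define y where "y = (\<lambda>n. residue x (n + k) div 2 ^ k)"
  have "y (Suc n) mod 2 ^ n = y n" for n
  proof -
    have "y (Suc n) mod 2 ^ n = residue x (Suc (n + k)) mod 2 ^ (n + k) div 2 ^ k"
      by (simp add: y_def power_add mult.commute[of "2 ^ n"] zmod_zmult2_eq)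
    then show ?thesis by (simp only: residue_Suc_mod y_def)
  qed
  then have res: "residue (Abs_padic2 y) = y"
    by (simp add: Abs_padic2_inverse)
  have "residue x n = residue (2 ^ k * Abs_padic2 y) n" for n
  proof -
    have "residue x (n + k) mod 2 ^ k = 0"
      using x0 residue_mod[of k "n + k" x] by simp
    then have "2 ^ k * y n = residue x (n + k)"
      by (simp add: y_def dvd_mult_div_cancel mod_0_imp_dvd)
    then show ?thesis
      using residue_mod[of n "n + k" x]
      by (simp add: residue_mult residue_two_power res mod_simps)
  qed
  then have "x = 2 ^ k * Abs_padic2 y" by (rule padic2_eqI)
  then show "2 ^ k dvd x" by (metis dvd_triv_left)
qed

text \<open>The 2-adic valuation, with the junk value of \<open>GREATEST\<close> at \<open>0\<close>.\<close>

definition padic2_val :: "padic2 \<Rightarrow> nat"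
  where "padic2_val x = (GREATEST k. 2 ^ k dvd x)"

lemma padic2_val_ge_iff:
  assumes "x \<noteq> 0"
  shows "k \<le> padic2_val x \<longleftrightarrow> 2 ^ k dvd x"
proof -
  obtain b where b: "residue x b \<noteq> 0"
    using assms padic2_eqI[of x 0] by auto
  have bound: "j \<le> b" if "2 ^ j dvd x" for j
    using that b residue_mod[of b j x] by (force simp: two_power_dvd_iff not_le)
  have "2 ^ padic2_val x dvd x"
    unfolding padic2_val_def by (rule GreatestI_nat[where k = 0 and b = b]) (auto intro: bound)
  moreover have "k \<le> padic2_val x" if "2 ^ k dvd x"
    unfolding padic2_val_def by (rule Greatest_le_nat[where b = b]) (auto intro: bound that)
  ultimately show ?thesis
    by (meson le_imp_power_dvd dvd_trans)
qed

text \<open>The 2-adic topology is that of the metric \<open>\<bar>x - y\<bar> = 2 ^ (- v(x - y))\<close>.\<close>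

instantiation padic2 :: metric_space
begin

definition dist_padic2 :: "padic2 \<Rightarrow> padic2 \<Rightarrow> real"
  where "dist x y = (if x = y then 0 else (1 / 2) ^ padic2_val (x - y))"

definition uniformity_padic2_def:
  "(uniformity :: (padic2 \<times> padic2) filter) = (INF e\<in>{0 <..}. principal {(x, y). dist x y < e})"

definition open_padic2_def:
  "open (U :: padic2 set) \<longleftrightarrow> (\<forall>x\<in>U. \<forall>\<^sub>F (x', y) in uniformity. x' = x \<longrightarrow> y \<in> U)"

lemma dist_padic2_le_iff: "dist x y \<le> (1 / 2) ^ k \<longleftrightarrow> residue x k = residue (y :: padic2) k"
proof (cases "x = y")
  case False
  then have "dist x y \<le> (1 / 2) ^ k \<longleftrightarrow> k \<le> padic2_val (x - y)"
    by (simp add: dist_padic2_def power_decreasing_iff)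
  also have "\<dots> \<longleftrightarrow> residue x k = residue y k"
    using False by (simp add: padic2_val_ge_iff two_power_dvd_iff residue_diff_eq_0_iff)
  finally show ?thesis .
qed (simp add: dist_padic2_def)

instance
proof
  fix x y z :: padic2
  show "dist x y = 0 \<longleftrightarrow> x = y"
    by (simp add: dist_padic2_def)
  show "dist x y \<le> dist x z + dist y z"
  proof (cases "x = z \<or> y = z")
    case True
    have "2 ^ k dvd x - y \<longleftrightarrow> 2 ^ k dvd y - x" for k
      by (metis dvd_minus_iff minus_diff_eq)
    then have "dist x y = dist y x"
      by (simp add: dist_padic2_def padic2_val_def)
    moreover have "dist x x = 0" "dist y y = 0"
      by (simp_all add: dist_padic2_def)
    ultimately show ?thesis using True by auto
  next
    case False
    define k where "k = min (padic2_val (x - z)) (padic2_val (y - z))"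
    have xz: "dist x z = (1 / 2) ^ padic2_val (x - z)" and yz: "dist y z = (1 / 2) ^ padic2_val (y - z)"
      using False by (simp_all add: dist_padic2_def)
    have "dist x z \<le> (1 / 2) ^ k" "dist y z \<le> (1 / 2) ^ k"
      unfolding xz yz k_def by (simp_all add: power_decreasing)
    then have "dist x y \<le> (1 / 2) ^ k"
      by (simp add: dist_padic2_le_iff)
    also have "\<dots> \<le> dist x z + dist y z"
      unfolding xz yz k_def by (simp add: min_def)
    finally show ?thesis .
  qed
qed (simp_all add: uniformity_padic2_def open_padic2_def)

end

lemma tendsto_padic2_iff:
  fixes f :: "'a \<Rightarrow> padic2"
  shows "(f \<longlongrightarrow> l) F \<longleftrightarrow> (\<forall>k. \<forall>\<^sub>F a in F. residue (f a) k = residue l k)"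
proof
  assume f: "(f \<longlongrightarrow> l) F"
  show "\<forall>k. \<forall>\<^sub>F a in F. residue (f a) k = residue l k"
  proof
    fix k
    have "\<forall>\<^sub>F a in F. dist (f a) l < (1 / 2) ^ k"
      using f by (rule tendstoD) simp
    then show "\<forall>\<^sub>F a in F. residue (f a) k = residue l k"
      by eventually_elim (simp flip: dist_padic2_le_iff)
  qed
next
  assume ev: "\<forall>k. \<forall>\<^sub>F a in F. residue (f a) k = residue l k"
  show "(f \<longlongrightarrow> l) F"
  proof (rule tendstoI)
    fix e :: real assume "0 < e"
    then obtain k where k: "(1 / 2) ^ k < e"
      using real_arch_pow_inv[of e "1 / 2"] by auto
    from ev have "\<forall>\<^sub>F a in F. residue (f a) k = residue l k" by blast
    then show "\<forall>\<^sub>F a in F. dist (f a) l < e"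
      by eventually_elim (use k in \<open>auto simp flip: dist_padic2_le_iff\<close>)
  qed
qed

end

theory Submission
  imports Defs
begin

text \<open>
  Passing to every fourth term turns the recurrence into one whose solutions are \<open>4 ^ m\<close> times
  integers. Along \<open>i = 4 * m + r\<close> with \<open>r = 2, 3, 4\<close> these integers are odd up to a constant factor,
  so \<open>\<nu>\<^sub>2 (U i) \<le> i / 2\<close>, whereas \<open>U (4 * m + 5) = 4 ^ (m + 2) * X m\<close> with \<open>X\<close> of alternating parity.
  The recurrence of \<open>X\<close> with step \<open>2 ^ k\<close> has coefficients \<open>a \<equiv> 2 (mod 4)\<close>, \<open>b\<close> odd and
  \<open>c \<equiv> 0 (mod 2 ^ (k + 2))\<close>; by induction on \<open>k\<close> it yields
  \<open>X (m + 2 ^ k) \<equiv> X m + 2 ^ k (mod 2 ^ (k + 1))\<close> whenever \<open>2 ^ k\<close> divides \<open>X m\<close> and \<open>m \<ge> 2 ^ k\<close>.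
  So the large \<open>m\<close> with \<open>2 ^ k\<close> dividing \<open>X m\<close> form one residue class modulo \<open>2 ^ k\<close>, and the
  2-adic integer is the limit of \<open>4 * m + 5\<close> along these classes.
\<close>

section \<open>Cubic recurrences under doubling of the step and scaling\<close>

definition cubic_rec :: "nat \<Rightarrow> int \<Rightarrow> int \<Rightarrow> int \<Rightarrow> (nat \<Rightarrow> int) \<Rightarrow> bool"
  where "cubic_rec h a b c f \<longleftrightarrow>
    (\<forall>m. f (m + 3 * h) = a * f (m + 2 * h) - b * f (m + h) + c * f m)"

text \<open>Graeffe's root squaring: with \<open>p(x) = x\<^sup>3 - a x\<^sup>2 + b x - c\<close>, add up the recurrence according to
  the coefficients of \<open>- p(- x)\<close>.\<close>

lemma cubic_rec_double:
  assumes "cubic_rec h a b c f"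
  shows "cubic_rec (2 * h) (a\<^sup>2 - 2 * b) (b\<^sup>2 - 2 * a * c) (c\<^sup>2) f"
  unfolding cubic_rec_def
proof
  fix m
  have r: "f (m + n + 3 * h) = a * f (m + n + 2 * h) - b * f (m + n + h) + c * f (m + n)" for n
    using assms unfolding cubic_rec_def by blast
  have 0: "f (m + 3 * h) = a * f (m + 2 * h) - b * f (m + h) + c * f m"
    using r[of 0] by simp
  have 1: "f (m + 4 * h) = a * f (m + 3 * h) - b * f (m + 2 * h) + c * f (m + h)"
    using r[of h] by (simp add: add.assoc flip: mult_2)
  have 2: "f (m + 5 * h) = a * f (m + 4 * h) - b * f (m + 3 * h) + c * f (m + 2 * h)"
    using r[of "2 * h"] by (simp add: add.assoc)
  have 3: "f (m + 6 * h) = a * f (m + 5 * h) - b * f (m + 4 * h) + c * f (m + 3 * h)"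
    using r[of "3 * h"] by (simp add: add.assoc)
  have "f (m + 6 * h) = (a\<^sup>2 - 2 * b) * f (m + 4 * h) - (b\<^sup>2 - 2 * a * c) * f (m + 2 * h) + c\<^sup>2 * f m"
    using 0 1 2 3 by algebra
  then show "f (m + 3 * (2 * h)) = (a\<^sup>2 - 2 * b) * f (m + 2 * (2 * h))
      - (b\<^sup>2 - 2 * a * c) * f (m + 2 * h) + c\<^sup>2 * f m"
    by simp
qed

text \<open>The coefficient of the term \<open>j\<close> steps back carries a factor
  \<open>4 ^ j\<close>, so the required divisibility propagates from three consecutive terms to the
  next.\<close>

lemma cubic_rec_scale:
  assumes f: "cubic_rec 1 (4 * a) (16 * b) (64 * c) f"
    and d: "d \<noteq> 0" "d dvd f 0" "d * 4 dvd f 1" "d * 16 dvd f 2"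
  obtains X where "cubic_rec 1 a b c X" "\<And>m. f m = d * 4 ^ m * X m"
proof
  define X where "X m = f m div (d * 4 ^ m)" for m
  have rec: "f (Suc (Suc (Suc m))) = 4 * a * f (Suc (Suc m)) - 16 * b * f (Suc m) + 64 * c * f m" for m
    using f by (simp add: cubic_rec_def eval_nat_numeral)
  have dvd: "d * 4 ^ m dvd f m \<and> d * 4 ^ Suc m dvd f (Suc m) \<and> d * 4 ^ Suc (Suc m) dvd f (Suc (Suc m))"
    for m
  proof (induction m)
    case 0
    then show ?case using d by (simp add: eval_nat_numeral)
  next
    case (Suc m)
    then obtain x y z where "f m = d * 4 ^ m * x" "f (Suc m) = d * 4 ^ Suc m * y"
      "f (Suc (Suc m)) = d * 4 ^ Suc (Suc m) * z"
      by (elim conjE dvdE)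
    then have "f (Suc (Suc (Suc m))) = d * 4 ^ Suc (Suc (Suc m)) * (a * z - b * y + c * x)"
      by (simp add: rec algebra_simps)
    then show ?case using Suc by (metis dvd_triv_left)
  qed
  show fX: "f m = d * 4 ^ m * X m" for m
    using dvd[of m] by (simp add: X_def)
  have "d * 4 ^ (m + 3) * X (m + 3) = d * 4 ^ (m + 3) * (a * X (m + 2) - b * X (m + 1) + c * X m)" for m
    using rec[of m] unfolding fX by (simp add: eval_nat_numeral algebra_simps)
  then show "cubic_rec 1 a b c X"
    using d(1) by (simp add: cubic_rec_def)
qed

text \<open>The step is doubled \<open>k\<close> times. For \<open>a\<close> even and
  \<open>b\<close> odd, \<open>a\<^sup>2 - 2 * b\<close> is 2 modulo 4; squaring \<open>c\<close>
  gains at least one factor 2 each time.\<close>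

lemma cubic_rec_power2:
  assumes "cubic_rec 1 a b c f" "a mod 4 = 2" "odd b" "4 dvd c"
  obtains a' b' c' where "cubic_rec (2 ^ k) a' b' c' f" "a' mod 4 = 2" "odd b'" "2 ^ (k + 2) dvd c'"
proof -
  have "\<exists>a' b' c'. cubic_rec (2 ^ k) a' b' c' f \<and> a' mod 4 = 2 \<and> odd b' \<and> 2 ^ (k + 2) dvd c'"
  proof (induction k)
    case 0
    then show ?case using assms by auto
  next
    case (Suc k)
    then obtain a' b' c' where *: "cubic_rec (2 ^ k) a' b' c' f" "a' mod 4 = 2" "odd b'" "2 ^ (k + 2) dvd c'"
      by blast
    have "(a'\<^sup>2 - 2 * b') mod 4 = 2"
    proof -
      obtain u where "a' = 4 * u + 2" using *(2) by (metis mult_div_mod_eq)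
      moreover obtain v where "b' = 2 * v + 1" using *(3) by (elim oddE)
      ultimately have "a'\<^sup>2 - 2 * b' = 2 + 4 * (4 * u\<^sup>2 + 4 * u - v)"
        by (simp add: power2_eq_square algebra_simps)
      then show ?thesis by (simp only: mod_mult_self2) simp
    qed
    moreover have "2 ^ (Suc k + 2) dvd c'\<^sup>2"
    proof -
      have "(2 ^ (k + 2))\<^sup>2 dvd c'\<^sup>2" using *(4) by (rule dvd_power_same)
      moreover have "(2 :: int) ^ (Suc k + 2) dvd (2 ^ (k + 2))\<^sup>2"
        unfolding power_mult[symmetric] by (rule le_imp_power_dvd) simp
      ultimately show ?thesis by (rule dvd_trans[rotated])
    qed
    moreover have "odd (b'\<^sup>2 - 2 * a' * c')" using *(3) by simp
    ultimately show ?case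
      using cubic_rec_double[OF *(1)] by (auto simp del: even_diff)
  qed
  then show ?thesis using that by blast
qed

lemma cubic_rec_parity:
  assumes "cubic_rec 1 a b c f" "even a" "odd b" "even c"
  shows "even (f (m + 3)) \<longleftrightarrow> even (f (m + 1))"
  using assms by (simp add: cubic_rec_def)

text \<open>From index 3 on, each term has the parity of the one two places before, so odd terms at
  1 and 2 start both chains.\<close>

lemma cubic_rec_odd:
  assumes "cubic_rec 1 a b c f" "even a" "odd b" "even c" "odd (f 1)" "odd (f 2)"
  shows "odd (f (Suc m))"
proof -
  have "odd (f (Suc m)) \<and> odd (f (Suc (Suc m)))"
  proof (induction m)
    case 0
    then show ?case using assms by (simp add: eval_nat_numeral)
  next
    case (Suc m)
    then show ?case using cubic_rec_parity[OF assms(1-4), of m] by (simp add: eval_nat_numeral)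
  qed
  then show ?thesis ..
qed

section \<open>Terms of an alternating sequence divisible by \<open>2 ^ k\<close>\<close>

locale alternating_cubic_rec =
  fixes X :: "nat \<Rightarrow> int" and a b c :: int
  assumes rec: "cubic_rec 1 a b c X" and a: "a mod 4 = 2" and b: "odd b" and c: "4 dvd c"
    and X1: "even (X 1)" and X2: "odd (X 2)"
begin

text \<open>\<open>X 0\<close> is exempt: its parity does not propagate, and in the application it
  is even like \<open>X 1\<close>.\<close>

lemma parity: "even (X (Suc m)) \<longleftrightarrow> even m"
proof -
  have "even a" "even c" using a c by presburger+
  note par = cubic_rec_parity[OF rec this(1) b this(2)]
  have "(even (X (Suc m)) \<longleftrightarrow> even m) \<and> (even (X (Suc (Suc m))) \<longleftrightarrow> odd m)"
  proof (induction m)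
    case 0
    then show ?case using X1 X2 by (simp add: eval_nat_numeral)
  next
    case (Suc m)
    then show ?case using par[of m] by (simp add: numeral_3_eq_3)
  qed
  then show ?thesis ..
qed

lemma shift:
  assumes "2 ^ k \<le> m" "2 ^ k dvd X m"
  shows "2 ^ Suc k dvd X (m + 2 ^ k) - X m - 2 ^ k"
  using assms
proof (induction k arbitrary: m)
  case 0
  then obtain n where "m = Suc n" by (cases m) auto
  then show ?case using parity[of n] parity[of "Suc n"] by simp
next
  case (Suc k)
  define h :: nat where "h = 2 ^ k"
  obtain a' b' c' where r: "cubic_rec h a' b' c' X" "a' mod 4 = 2" "odd b'" "2 ^ (k + 2) dvd c'"
    unfolding h_def by (rule cubic_rec_power2[OF rec a b c])
  have hm: "2 * h \<le> m" using Suc.prems by (simp add: h_def)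
  \<comment> \<open>Starting the recurrence one step before \<open>m\<close> makes its last term
    vanish modulo \<open>2 ^ (k + 2)\<close>. In \<open>a' * X (m + h) - b' * X m\<close>, the
    product \<open>a' * 2 ^ k\<close> then supplies the new summand
    \<open>2 ^ Suc k\<close>.\<close>
  then obtain l where l: "m = l + h" by (metis add.commute le_iff_add mult_2 add_leD1)
  have 1: "X (m + 2 * h) = a' * X (m + h) - b' * X m + c' * X l"
    using r(1)[unfolded cubic_rec_def, rule_format, of l] by (simp add: l add.assoc flip: mult_2)
  obtain x where x: "X m = 2 ^ Suc k * x" using Suc.prems by (elim dvdE)
  have "2 ^ Suc k dvd X (m + h) - X m - 2 ^ k"
    unfolding h_def using hm Suc.prems by (intro Suc.IH) (auto simp: h_def x)
  then obtain y where y: "X (m + h) = X m + 2 ^ k + 2 ^ Suc k * y"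
    by (elim dvdE) (simp add: algebra_simps)
  obtain u where u: "a' = 4 * u + 2" using r(2) by (metis mult_div_mod_eq)
  obtain v where v: "b' = 2 * v + 1" using r(3) by (elim oddE)
  obtain w where w: "c' = 2 ^ (k + 2) * w" using r(4) by (elim dvdE)
  have "X (m + 2 * h) - X m - 2 ^ Suc k
      = 2 ^ Suc (Suc k) * (2 * u * x + u + 2 * u * y + y - v * x + w * X l)"
    unfolding 1 y x
    by (simp add: u v w algebra_simps)
  then show ?case by (simp add: h_def)
qed

text \<open>A shift preserves divisibility by \<open>2 ^ k\<close>, so \<open>shift\<close> can be
  iterated.\<close>

lemma shift_mult:
  assumes "2 ^ k \<le> m" "2 ^ k dvd X m"
  shows "2 ^ Suc k dvd X (m + 2 ^ k * d) - X m - 2 ^ k * int d"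
proof (induction d)
  case (Suc d)
  let ?n = "m + 2 ^ k * d"
  have "2 ^ k dvd X ?n - X m - 2 ^ k * int d"
    using Suc by (rule dvd_trans[rotated]) simp
  then have "2 ^ k dvd X ?n - X m - 2 ^ k * int d + X m + 2 ^ k * int d"
    using assms(2) by (intro dvd_add) auto
  then have "2 ^ k dvd X ?n" by simp
  then have "2 ^ Suc k dvd X (?n + 2 ^ k) - X ?n - 2 ^ k"
    using assms(1) by (intro shift) auto
  from dvd_add[OF this Suc] show ?case by (simp add: algebra_simps)
qed simp

text \<open>Lifting from \<open>2 ^ k\<close> to \<open>2 ^ Suc k\<close> becomes a condition on the
  parity of \<open>d\<close>, as in Hensel lifting.\<close>

lemma dvd_shift_iff:
  assumes "2 ^ k \<le> m" "2 ^ k dvd X m"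
  shows "2 ^ Suc k dvd X (m + 2 ^ k * d) \<longleftrightarrow> 2 ^ Suc k dvd X m + 2 ^ k * int d"
proof -
  let ?x = "X (m + 2 ^ k * d)" and ?y = "X m + 2 ^ k * int d"
  have "2 ^ Suc k dvd ?x - ?y"
    using shift_mult[OF assms, of d] by (simp only: diff_diff_eq)
  then have "2 ^ Suc k dvd ?x - ?y + ?y \<longleftrightarrow> 2 ^ Suc k dvd ?y"
    by (rule dvd_add_right_iff)
  then show ?thesis by (simp only: diff_add_cancel)
qed

text \<open>Two solutions congruent modulo \<open>2 ^ k\<close> differ by \<open>2 ^ k * d\<close>,
  and the lifting criterion forces \<open>d\<close> to be even.\<close>

lemma class_unique:
  assumes "2 ^ k \<le> m" "2 ^ k \<le> n" "2 ^ k dvd X m" "2 ^ k dvd X n"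
  shows "m mod 2 ^ k = n mod 2 ^ k"
  using assms
proof (induction k arbitrary: m n)
  case (Suc k)
  have *: "m mod 2 ^ Suc k = n mod 2 ^ Suc k"
    if le: "m \<le> n" and that: "2 ^ Suc k \<le> m" "2 ^ Suc k dvd X m" "2 ^ Suc k dvd X n" for m n
  proof -
    have k: "2 ^ k \<le> m" "2 ^ k dvd X m" "2 ^ k dvd X n"
      using that by (auto elim: dvd_trans[rotated])
    then have "m mod 2 ^ k = n mod 2 ^ k"
      using le by (intro Suc.IH) auto
    then obtain d where d: "n = m + 2 ^ k * d"
      using le by (rule mod_eq_nat2E)
    have "2 ^ Suc k dvd X m + 2 ^ k * int d"
      using dvd_shift_iff[OF k(1,2), of d] that(3) d by blast
    then have "2 ^ Suc k dvd 2 ^ k * int d"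
      using that(2) by (metis dvd_add_right_iff)
    then have "even d" by simp
    then obtain b where "d = 2 * b" by (elim evenE)
    then have "n = m + 2 ^ Suc k * b" using d by simp
    then show ?thesis by (simp only: mod_mult_self2)
  qed
  show ?case
    using *[of m n] *[of n m] Suc.prems by (metis nle_le)
qed simp

lemma class_exists: "\<exists>m. 2 ^ k \<le> m \<and> 2 ^ k dvd X m"
proof (induction k)
  case 0
  then show ?case by auto
next
  case (Suc k)
  then obtain m where m: "2 ^ k \<le> m" "2 ^ k dvd X m" by blast
  then obtain x where x: "X m = 2 ^ k * x" by (elim dvdE)
  \<comment> \<open>\<open>d\<close> has the parity of \<open>x\<close>; being positive, it moves
    the index to at least \<open>2 ^ Suc k\<close>.\<close>
  define d :: nat where "d = (if even x then 2 else 3)"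
  have "X m + 2 ^ k * int d = 2 ^ k * (x + int d)" by (simp add: x algebra_simps)
  moreover have "even (x + int d)" by (simp add: d_def)
  ultimately have "2 ^ Suc k dvd X m + 2 ^ k * int d" by simp
  then have "2 ^ Suc k dvd X (m + 2 ^ k * d)" using dvd_shift_iff[OF m] by blast
  moreover have "2 ^ Suc k \<le> m + 2 ^ k * d" by (simp add: d_def)
  ultimately show ?case by blast
qed

end

lemma multiplicity_2_int:
  assumes "u > 0"
  shows "multiplicity 2 (int u) = multiplicity 2 u"
proof (rule multiplicity_eqI)
  have *: "(2 :: int) ^ n dvd int u \<longleftrightarrow> 2 ^ n dvd u" for n
    by (metis int_dvd_int_iff of_nat_numeral of_nat_power)
  show "2 ^ multiplicity 2 u dvd int u"
    unfolding * by (rule multiplicity_dvd)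
  show "\<not> 2 ^ Suc (multiplicity 2 u) dvd int u"
    unfolding * using assms by (subst power_dvd_iff_le_multiplicity) auto
qed

theorem theorem6p3:
  fixes U :: "nat \<Rightarrow> nat"
  assumes "U 0 = 1" and "U 1 = 13" and "U 2 = 163"
    and "\<And>i. U (i + 3) = 12 * U (i + 2) + 6 * U (i + 1) + 12 * U i"
  shows "\<exists>!\<zeta> :: padic2. \<forall>i :: nat \<Rightarrow> nat.
    filterlim (\<lambda>n. real (multiplicity 2 (U (i n))) - real (i n) / 2) at_top sequentially
      \<longrightarrow> (\<lambda>n. of_nat (i n) :: padic2) \<longlonglongrightarrow> \<zeta>"
proof -

  \<comment> \<open>The recurrence with step 4 and its initial values\<close>
  define V where "V i = int (U i)" for i
  have "cubic_rec 1 12 (-6) 12 V"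
    by (simp add: cubic_rec_def V_def assms(4) del: One_nat_def)
  \<comment> \<open>The factors 4, 16 and 64 are split off the coefficients 24840, 18576 and 20736
    to prepare the scaling.\<close>
  from cubic_rec_double[OF cubic_rec_double[OF this]]
  have rec4: "cubic_rec 4 (4 * 6210) (16 * 1161) (64 * 324) V"
    by simp
  have rec4': "cubic_rec 1 (4 * 6210) (16 * 1161) (64 * 324) (\<lambda>m. V (4 * m + r))" for r
    unfolding cubic_rec_def
  proof
    fix m
    show "V (4 * (m + 3 * 1) + r) = 4 * 6210 * V (4 * (m + 2 * 1) + r)
        - 16 * 1161 * V (4 * (m + 1) + r) + 64 * 324 * V (4 * m + r)"
      using rec4[unfolded cubic_rec_def, rule_format, of "4 * m + r"]
      by (simp add: algebra_simps)
  qed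
  have V_rec: "V (i + 3) = 12 * V (i + 2) + 6 * V (i + 1) + 12 * V i" for i
    using assms(4)[of i] by (simp add: V_def)
  have V012: "V 0 = 1" "V 1 = 13" "V 2 = 163"
    using assms by (simp_all add: V_def)
  \<comment> \<open>Each class \<open>4 * m + r\<close> with \<open>r\<close> from 2 to 5 needs
    three initial terms, the last being \<open>V 13\<close>.\<close>
  have V3: "V 3 = 2046" using V_rec[of 0] V012 by (simp add: numeral_2_eq_2)
  have V4: "V 4 = 25686" using V_rec[of 1] V012 V3 by (simp add: eval_nat_numeral)
  have V5: "V 5 = 322464" using V_rec[of 2] V012 V3 V4 by simp
  have V6: "V 6 = 4048236" using V_rec[of 3] V3 V4 V5 by simp
  have V7: "V 7 = 50821848" using V_rec[of 4] V4 V5 V6 by simp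
  have V8: "V 8 = 638021160" using V_rec[of 5] V5 V6 V7 by simp
  have V9: "V 9 = 8009763840" using V_rec[of 6] V6 V7 V8 by simp
  have V10: "V 10 = 100555155216" using V_rec[of 7] V7 V8 V9 by simp
  have V11: "V 11 = 1262376699552" using V_rec[of 8] V8 V9 V10 by simp
  have V12: "V 12 = 15847968492000" using V_rec[of 9] V9 V10 V11 by simp
  have V13: "V 13 = 198956543963904" using V_rec[of 10] V10 V11 V12 by simp
  note V_eval = V012 V3 V4 V5 V6 V7 V8 V9 V10 V11 V12 V13
  have pos: "U i > 0" for i
  proof -
    have "U i > 0 \<and> U (Suc i) > 0 \<and> U (Suc (Suc i)) > 0"
      using assms by (induction i) (auto simp: eval_nat_numeral)
    then show ?thesis ..
  qed

  \<comment> \<open>Valuations outside the indices \<open>4 * m + 5\<close>\<close>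
  have small: "real (multiplicity 2 (U i)) - real i / 2 \<le> 0" if "\<nexists>m. i = 4 * m + 5" for i
  proof -
    \<comment> \<open>Here \<open>2 ^ e\<close> is the constant factor of the class. The remaining
      quotients are odd, so the valuation is \<open>e + 2 * m\<close>, at most
      \<open>i / 2\<close>.\<close>
    have half: ?thesis
      if i: "i = 4 * m + r" and r: "2 * e \<le> r"
        and d: "2 ^ e dvd V r" "2 ^ e * 4 dvd V (4 + r)" "2 ^ e * 16 dvd V (8 + r)"
        and o: "odd (V r div 2 ^ e)" "odd (V (4 + r) div (2 ^ e * 4))"
          "odd (V (8 + r) div (2 ^ e * 16))" for m r e
    proof -
      obtain X where X: "cubic_rec 1 6210 1161 324 X" "\<And>m. V (4 * m + r) = 2 ^ e * 4 ^ m * X m"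
        by (rule cubic_rec_scale[OF rec4', of "2 ^ e" r]) (use d in auto)
      have "odd (X 0)" "odd (X 1)" "odd (X 2)"
        using o X(2)[of 0] X(2)[of 1] X(2)[of 2] by auto
      then have "odd (X m)"
        using cubic_rec_odd[OF X(1)] by (cases m) auto
      moreover from this have "X m \<noteq> 0" by (metis even_zero)
      moreover have "int (U i) = 2 ^ (e + 2 * m) * X m"
        using X(2)[of m] by (simp add: i V_def power_add power_mult)
      ultimately have "multiplicity 2 (int (U i)) = e + 2 * m"
        by (simp add: prime_elem_multiplicity_mult_distrib not_dvd_imp_multiplicity_0)
      then show ?thesis
        using r pos[of i] by (simp add: multiplicity_2_int i)
    qed
    \<comment> \<open>\<open>U 0\<close> and \<open>U 1\<close> are odd and precede the starting
      indices 4 and 5 of their classes.\<close>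
    have "i = 0 \<or> i = 1 \<or> (\<exists>m. i = 4 * m + 2 \<or> i = 4 * m + 3 \<or> i = 4 * m + 4)"
      using that by presburger
    then consider "i = 0" | "i = 1" | m where "i = 4 * m + 2" | m where "i = 4 * m + 3"
      | m where "i = 4 * m + 4" by blast
    then show ?thesis
    proof cases
      case (3 m)
      then show ?thesis by (rule half[of m 2 0]) (simp_all add: V_eval)
    next
      case (4 m)
      then show ?thesis by (rule half[of m 3 1]) (simp_all add: V_eval)
    next
      case (5 m)
      then show ?thesis by (rule half[of m 4 1]) (simp_all add: V_eval)
    qed (use assms in \<open>simp_all add: not_dvd_imp_multiplicity_0\<close>)
  qed

  \<comment> \<open>Valuations at the indices \<open>4 * m + 5\<close>\<close>
  obtain X where X: "cubic_rec 1 6210 1161 324 X" "\<And>m. V (4 * m + 5) = 16 * 4 ^ m * X m"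
    by (rule cubic_rec_scale[OF rec4', of 16 5]) (auto simp: V_eval)
  interpret alternating_cubic_rec X 6210 1161 324
  proof
    show "even (X 1)" "odd (X 2)"
      using X(2)[of 1] X(2)[of 2] by (simp_all add: V_eval)
  qed (use X(1) in simp_all)
  have X0: "X m \<noteq> 0" for m
    using X(2)[of m] pos[of "4 * m + 5"] by (auto simp: V_def)
  \<comment> \<open>The constant is \<open>2 * m + 4 - (4 * m + 5) / 2\<close>.\<close>
  have mult: "real (multiplicity 2 (U (4 * m + 5))) - real (4 * m + 5) / 2
      = real (multiplicity 2 (X m)) + 3 / 2" for m
  proof -
    have "multiplicity 2 (U (4 * m + 5)) = multiplicity (2 :: int) (V (4 * m + 5))"
      unfolding V_def using pos by (simp add: multiplicity_2_int)
    also have "V (4 * m + 5) = 2 ^ (2 * m + 4) * X m"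
      by (simp add: X(2) power_add power_mult)
    also have "multiplicity 2 \<dots> = 2 * m + 4 + multiplicity 2 (X m)"
      using X0 by (simp add: prime_elem_multiplicity_mult_distrib)
    finally show ?thesis by (simp add: field_simps)
  qed

  \<comment> \<open>Construction of the limit\<close>
  define r where "r k = (SOME m. 2 ^ k \<le> m \<and> 2 ^ k dvd X m)" for k
  have r: "2 ^ k \<le> r k" "2 ^ k dvd X (r k)" for k
    unfolding r_def using someI_ex[OF class_exists[of k]] by blast+
  have r_unique: "(4 * int m + 5) mod 2 ^ k = (4 * int (r k) + 5) mod 2 ^ k"
    if "2 ^ k \<le> m" "2 ^ k dvd X m" for k m
  proof -
    have "int (m mod 2 ^ k) = int (r k mod 2 ^ k)"
      using class_unique[OF that(1) r(1) that(2) r(2)] by simp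
    then have "int m mod 2 ^ k = int (r k) mod 2 ^ k"
      by (simp add: zmod_int)
    then show ?thesis by (metis mod_add_left_eq mod_mult_right_eq)
  qed
  define z where "z k = (4 * int (r k) + 5) mod 2 ^ k" for k
  have "z (Suc k) mod 2 ^ k = z k" for k
  proof -
    have "2 ^ k \<le> r (Suc k)" "2 ^ k dvd X (r (Suc k))"
      using r[of "Suc k"] by (auto elim: dvd_trans[rotated])
    then show ?thesis
      unfolding z_def mod_pow2_Suc_mod by (rule r_unique)
  qed
  then have z: "residue (Abs_padic2 z) = z"
    by (simp add: Abs_padic2_inverse)

  \<comment> \<open>Convergence and uniqueness\<close>
  have lim: "(\<lambda>n. of_nat (i n) :: padic2) \<longlonglongrightarrow> Abs_padic2 z"
    if i: "filterlim (\<lambda>n. real (multiplicity 2 (U (i n))) - real (i n) / 2) at_top sequentially"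
    for i :: "nat \<Rightarrow> nat"
    unfolding tendsto_padic2_iff
  proof
    fix k
    \<comment> \<open>The sum dominates every valuation with \<open>m < 2 ^ k\<close>, forcing
      \<open>2 ^ k \<le> m\<close>; the summand \<open>k\<close> gives \<open>2 ^ k dvd X m\<close>,
      and 2 absorbs the constant \<open>3 / 2\<close>.\<close>
    define B where "B = k + 2 + (\<Sum>m<2 ^ k. multiplicity 2 (X m))"
    have "\<forall>\<^sub>F n in sequentially. real B < real (multiplicity 2 (U (i n))) - real (i n) / 2"
      using i by (simp add: filterlim_at_top_dense)
    then show "\<forall>\<^sub>F n in sequentially. residue (of_nat (i n)) k = residue (Abs_padic2 z) k"
    proof eventually_elim
      case (elim n)
      then have "\<exists>m. i n = 4 * m + 5" using small[of "i n"] by force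
      then obtain m where m: "i n = 4 * m + 5" ..
      have large: "B < multiplicity 2 (X m) + 2"
        using elim unfolding m mult by linarith
      have "2 ^ k \<le> m"
      proof (rule ccontr)
        assume "\<not> 2 ^ k \<le> m"
        then have "multiplicity 2 (X m) \<le> (\<Sum>m<2 ^ k. multiplicity 2 (X m))"
          by (intro member_le_sum) auto
        then show False using large by (simp add: B_def)
      qed
      moreover have "2 ^ k dvd X m"
        using large by (intro multiplicity_dvd') (simp add: B_def)
      ultimately show ?case
        unfolding residue_of_nat z m z_def using r_unique by simp
    qed
  qed
  \<comment> \<open>Uniqueness needs at least one admissible sequence; the chosen representatives
    provide it.\<close>
  have r_lim: "filterlim (\<lambda>n. real (multiplicity 2 (U (4 * r n + 5))) - real (4 * r n + 5) / 2)
      at_top sequentially"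
    unfolding mult
  proof (rule filterlim_at_top_mono)
    show "filterlim (\<lambda>n. 3 / 2 + real n) at_top sequentially"
      by (intro filterlim_tendsto_add_at_top[OF tendsto_const] filterlim_real_sequentially)
    have "n \<le> multiplicity 2 (X (r n))" for n
      using r(2) X0 by (intro multiplicity_geI) auto
    then show "\<forall>\<^sub>F n in sequentially. 3 / 2 + real n \<le> real (multiplicity 2 (X (r n))) + 3 / 2"
      by simp
  qed
  show ?thesis
  proof (intro ex1I[of _ "Abs_padic2 z"] allI impI)
    fix \<zeta> :: padic2
    let ?i = "\<lambda>n. 4 * r n + 5"
    assume *: "\<forall>i. filterlim (\<lambda>n. real (multiplicity 2 (U (i n))) - real (i n) / 2) at_top sequentially
      \<longrightarrow> (\<lambda>n. of_nat (i n)) \<longlonglongrightarrow> \<zeta>"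
    have "(\<lambda>n. of_nat (?i n)) \<longlonglongrightarrow> \<zeta>"
      by (rule *[rule_format, of ?i, OF r_lim])
    then show "\<zeta> = Abs_padic2 z" using lim[of ?i, OF r_lim] by (rule LIMSEQ_unique)
  qed (rule lim)
qed

end
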